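(* For all integers $n\ge 0$, \[ a^{-\{1\}}_{4,1}(n)\ge a^{-\{1\}}_{4,3}(n). \]
   Context: A partition of $n$ is a non-increasing sequence of positive integers summing to $n$; its Young diagram is the left-justified array of boxes whose $i$-th row has $\lambda_i$ boxes. The hook length of a box is the number of boxes directly to its right, plus the number directly below it, plus $1$; a box of hook length $k$ is a $k$-hook. For $t\ge 2$, a $t$-core partition is a partition none of whose hook lengths is divisible by $t$. For a set $C$ of positive integers, $a^{-C}_{t,k}(n)$ denotes the total number of hooks of length $k$ summed over all $t$-core partitions of $n$ none of whose parts belongs to $C$. *)

theory Defs
  imports Main
begin

definition partitions :: "nat \<Rightarrow> nat list set" where
  "partitions n = {xs. sorted_wrt (\<ge>) xs \<and> (\<forall>x\<in>set xs. 0 < x) \<and> sum_list xs = n}"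

text \<open>A box is a pair (row, column), both counted from 0.\<close>

definition young_diagram :: "nat list \<Rightarrow> (nat \<times> nat) set" where
  "young_diagram xs = {(i, j). i < length xs \<and> j < xs ! i}"

fun hook_length :: "nat list \<Rightarrow> nat \<times> nat \<Rightarrow> nat" where
  "hook_length xs (i, j) =
     card {j'. j < j' \<and> (i, j') \<in> young_diagram xs}
     + card {i'. i < i' \<and> (i', j) \<in> young_diagram xs} + 1"

definition is_core :: "nat \<Rightarrow> nat list \<Rightarrow> bool" where
  "is_core t xs \<longleftrightarrow> (\<forall>b\<in>young_diagram xs. \<not> t dvd hook_length xs b)"

definition hook_count :: "nat \<Rightarrow> nat list \<Rightarrow> nat" where
  "hook_count k xs = card {b \<in> young_diagram xs. hook_length xs b = k}"

definition core_hooks_avoiding :: "nat set \<Rightarrow> nat \<Rightarrow> nat \<Rightarrow> nat \<Rightarrow> nat" where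
  "core_hooks_avoiding C t k n =
     (\<Sum>xs \<in> {xs \<in> partitions n. is_core t xs \<and> set xs \<inter> C = {}}. hook_count k xs)"

text \<open>
  The next three lemmas show that every \<open>card\<close> and the sum above range over finite sets,
  so the conventions for infinite sets play no role.
\<close>

lemma finite_partitions: "finite (partitions n)"
proof (rule finite_subset)
  have len: "length xs \<le> sum_list xs" if "\<forall>x\<in>set xs. 0 < x" for xs :: "nat list"
    using that by (induction xs) auto
  show "partitions n \<subseteq> {xs. set xs \<subseteq> {..n} \<and> length xs \<le> n}"
    using len member_le_sum_list unfolding partitions_def by fastforce
  show "finite {xs. set xs \<subseteq> {..n} \<and> length xs \<le> n}"
    by (rule finite_lists_length_le) simp
qed

lemma finite_young_diagram: "finite (young_diagram xs)"
proof -
  have "young_diagram xs = (SIGMA i:{..<length xs}. {..<xs ! i})"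
    unfolding young_diagram_def by auto
  then show ?thesis by simp
qed

lemma finite_arm_leg:
  "finite {j'. j < j' \<and> (i, j') \<in> young_diagram xs}"
  "finite {i'. i < i' \<and> (i', j) \<in> young_diagram xs}"
  unfolding young_diagram_def by simp_all

end

theory Submission
  imports Defs
begin

text \<open>
  Encode a partition by the set of its first-column hook lengths (its beta-set) \<open>B\<close>: hooks of
  length \<open>k\<close> correspond to the \<open>x \<in> B\<close> with \<open>k \<le> x\<close> and \<open>x - k \<notin> B\<close>. For a 4-core,
  \<open>B\<close> is closed under subtracting 4; since there is no part 0 or 1, also \<open>0, 1 \<notin> B\<close>, so \<open>B\<close> only
  meets the residue classes 2 and 3 modulo 4. The inequality then holds for each partition
  separately: sending \<open>x\<close> to \<open>x - 1\<close> if \<open>x - 1 \<in> B\<close>, and to \<open>x\<close> otherwise, maps the 3-hooks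
  injectively to the 1-hooks.
\<close>

section \<open>Beta-numbers and legs\<close>

definition beta :: "nat list \<Rightarrow> nat \<Rightarrow> nat" where
  "beta xs i = xs ! i + (length xs - Suc i)"

definition beta_set :: "nat list \<Rightarrow> nat set" where
  "beta_set xs = beta xs ` {..<length xs}"

definition leg :: "nat list \<Rightarrow> nat \<Rightarrow> nat \<Rightarrow> nat" where
  "leg xs i j = card {i'. i < i' \<and> i' < length xs \<and> j < xs ! i'}"

lemma hook_length_eq_leg:
  assumes "(i, j) \<in> young_diagram xs"
  shows "hook_length xs (i, j) = xs ! i - j + leg xs i j"
proof -
  have "{j'. j < j' \<and> (i, j') \<in> young_diagram xs} = {j<..<xs ! i}"
    using assms by (auto simp: young_diagram_def)
  moreover have "{i'. i < i' \<and> (i', j) \<in> young_diagram xs}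
      = {i'. i < i' \<and> i' < length xs \<and> j < xs ! i'}"
    by (auto simp: young_diagram_def)
  ultimately have "hook_length xs (i, j) = xs ! i - Suc j + leg xs i j + 1"
    by (simp add: leg_def)
  moreover have "j < xs ! i" using assms by (simp add: young_diagram_def)
  ultimately show ?thesis by linarith
qed

lemma leg_le: "leg xs i j \<le> length xs - Suc i"
proof -
  have "leg xs i j \<le> card {i<..<length xs}"
    unfolding leg_def by (rule card_mono) auto
  then show ?thesis by simp
qed

lemma leg_antimono:
  assumes "j \<le> j'"
  shows "leg xs i j' \<le> leg xs i j"
  unfolding leg_def using assms by (intro card_mono) auto

text \<open>Rows weakly decrease, so if row \<open>i'\<close> reaches column \<open>j\<close>, then
  so do all rows above it; hence every row in \<open>{i<..i'}\<close> contributes to the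
  leg.\<close>

lemma leg_ge:
  assumes "sorted_wrt (\<ge>) xs" "i' < length xs" "j < xs ! i'"
  shows "i' - i \<le> leg xs i j"
proof -
  have "xs ! i' \<le> xs ! m" if "m \<le> i'" for m
    using that assms sorted_wrt_nth_less[OF assms(1), of m i'] by (cases "m = i'") auto
  then have "card {i<..i'} \<le> leg xs i j"
    unfolding leg_def using assms by (intro card_mono) fastforce+
  then show ?thesis by simp
qed

text \<open>Counterpart of \<open>leg_ge\<close>: once row \<open>i'\<close> misses column
  \<open>j\<close>, so do all later rows, which leaves only the rows strictly between
  \<open>i\<close> and \<open>i'\<close>.\<close>

lemma leg_less:
  assumes "sorted_wrt (\<ge>) xs" "i < i'" "xs ! i' \<le> j"
  shows "leg xs i j < i' - i"
proof -
  have "xs ! m \<le> xs ! i'" if "i' \<le> m" "m < length xs" for m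
    using that sorted_wrt_nth_less[OF assms(1), of i' m] by (cases "m = i'") auto
  then have "leg xs i j \<le> card {i<..<i'}"
    unfolding leg_def using assms by (intro card_mono) (auto, meson leD le_trans not_le_imp_less)
  then show ?thesis using assms by simp
qed

lemma beta_strict_antimono:
  assumes "sorted_wrt (\<ge>) xs" "i < i'" "i' < length xs"
  shows "beta xs i' < beta xs i"
  using sorted_wrt_nth_less[OF assms(1), of i i'] assms by (auto simp: beta_def)

lemma inj_on_beta:
  assumes "sorted_wrt (\<ge>) xs"
  shows "inj_on (beta xs) {..<length xs}"
proof (rule linorder_inj_onI)
  fix i i' assume "i < i'" "i \<in> {..<length xs}" "i' \<in> {..<length xs}"
  then show "beta xs i \<noteq> beta xs i'"
    using beta_strict_antimono[OF assms, of i i'] by simp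
qed auto

section \<open>Hooks of a row read off from the beta-set\<close>

lemma inj_on_hook_length_row:
  assumes "i < length xs"
  shows "inj_on (\<lambda>j. hook_length xs (i, j)) {..<xs ! i}"
proof (rule linorder_inj_onI)
  fix j j' assume j: "j < j'" "j \<in> {..<xs ! i}" "j' \<in> {..<xs ! i}"
  then show "hook_length xs (i, j) \<noteq> hook_length xs (i, j')"
    using assms leg_antimono[of j j' xs i]
    by (simp add: hook_length_eq_leg young_diagram_def del: hook_length.simps)
qed auto

text \<open>Compare the summands \<open>xs ! i - j\<close> and \<open>leg xs i j\<close> with
  \<open>xs ! i - xs ! i'\<close> and \<open>i' - i\<close>. If row \<open>i'\<close> reaches column
  \<open>j\<close>, the first is larger and the second at least as large; otherwise the first is at
  most as large and the second smaller. Either way the sums differ.\<close>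

lemma hook_length_neq_beta_diff:
  assumes "sorted_wrt (\<ge>) xs" "(i, j) \<in> young_diagram xs" "i < i'" "i' < length xs"
  shows "hook_length xs (i, j) \<noteq> beta xs i - beta xs i'"
proof -
  have d: "beta xs i - beta xs i' = xs ! i - xs ! i' + (i' - i)"
    using sorted_wrt_nth_less[OF assms(1), of i i'] assms by (auto simp: beta_def)
  have "j < xs ! i" using assms by (simp add: young_diagram_def)
  moreover have "xs ! i' \<le> xs ! i"
    using sorted_wrt_nth_less[OF assms(1), of i i'] assms by simp
  ultimately show ?thesis
    unfolding hook_length_eq_leg[OF assms(2)] d
    using leg_ge[OF assms(1,4), of j i] leg_less[OF assms(1,3), of j] assms(3)
    by (cases "j < xs ! i'") auto
qed

text \<open>The two sets on the left are disjoint and their sizes add up to \<^term>\<open>beta xs i\<close>.\<close>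

lemma hook_lengths_row:
  assumes "sorted_wrt (\<ge>) xs" "i < length xs"
  shows "(\<lambda>j. hook_length xs (i, j)) ` {..<xs ! i}
    \<union> (\<lambda>i'. beta xs i - beta xs i') ` {i<..<length xs} = {1..beta xs i}"
    (is "?H \<union> ?D = _")
proof (rule card_subset_eq)
  have box: "(i, j) \<in> young_diagram xs" if "j < xs ! i" for j
    using that assms by (simp add: young_diagram_def)
  have "?H \<subseteq> {1..beta xs i}"
  proof
    fix h assume "h \<in> ?H"
    then obtain j where "j < xs ! i" "h = hook_length xs (i, j)" by blast
    then show "h \<in> {1..beta xs i}"
      using hook_length_eq_leg[OF box, of j] leg_le[of xs i j] by (simp add: beta_def)
  qed
  moreover have "?D \<subseteq> {1..beta xs i}"
    using beta_strict_antimono[OF assms(1)] by fastforce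
  ultimately show "?H \<union> ?D \<subseteq> {1..beta xs i}" by blast
  have "?H \<inter> ?D = {}"
    using hook_length_neq_beta_diff[OF assms(1) box] by (auto simp del: hook_length.simps)
  moreover have "card ?H = xs ! i"
    using card_image[OF inj_on_hook_length_row[OF assms(2)]] by simp
  moreover have "inj_on (\<lambda>i'. beta xs i - beta xs i') {i<..<length xs}"
  proof (rule inj_onI)
    fix m m' assume m: "m \<in> {i<..<length xs}" "m' \<in> {i<..<length xs}"
      and eq: "beta xs i - beta xs m = beta xs i - beta xs m'"
    \<comment> \<open>Both values lie below \<open>beta xs i\<close>, so the subtraction is not
      truncated and can be cancelled.\<close>
    have "beta xs m = beta xs m'"
      using m eq beta_strict_antimono[OF assms(1), of i m] beta_strict_antimono[OF assms(1), of i m']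
      by simp
    then show "m = m'"
      using m inj_onD[OF inj_on_beta[OF assms(1)], of m m'] by simp
  qed
  then have "card ?D = length xs - Suc i"
    by (simp add: card_image)
  ultimately show "card (?H \<union> ?D) = card {1..beta xs i}"
    by (simp add: card_Un_disjoint beta_def del: hook_length.simps)
qed simp

text \<open>Hook lengths within a row are distinct, so a \<open>k\<close>-hook is determined by its
  row. By \<open>hook_lengths_row\<close>, row \<open>i\<close> has one iff \<open>k\<close> is at
  most \<open>beta xs i\<close> and is no difference to a later beta-number. Earlier rows have
  larger beta-numbers, so the latter says that \<open>beta xs i - k\<close> is not in the
  beta-set.\<close>

lemma bij_betw_hooks_beta_set:
  assumes "sorted_wrt (\<ge>) xs" "0 < k"
  shows "bij_betw (\<lambda>(i, j). beta xs i) {b \<in> young_diagram xs. hook_length xs b = k}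
    {x \<in> beta_set xs. k \<le> x \<and> x - k \<notin> beta_set xs}" (is "bij_betw ?f ?A ?B")
proof -
  have "inj_on ?f ?A"
  proof (rule inj_onI, clarify)
    fix i j i' j'
    assume b: "(i, j) \<in> young_diagram xs" "(i', j') \<in> young_diagram xs"
      and h: "hook_length xs (i', j') = hook_length xs (i, j)"
      and "beta xs i = beta xs i'"
    then have [simp]: "i' = i"
      using inj_onD[OF inj_on_beta[OF assms(1)], of i i'] by (simp add: young_diagram_def)
    show "i = i' \<and> j = j'"
      using b h inj_onD[OF inj_on_hook_length_row, of i xs j j']
      by (simp add: young_diagram_def del: hook_length.simps)
  qed
  moreover have "?f ` ?A \<subseteq> ?B"
  proof clarify
    fix i j assume b: "(i, j) \<in> young_diagram xs" and k: "k = hook_length xs (i, j)"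
    then have i: "i < length xs" "j < xs ! i" by (auto simp: young_diagram_def)
    have "k \<in> {1..beta xs i}"
      unfolding hook_lengths_row[OF assms(1) i(1), symmetric] k using i(2) by blast
    then have le: "k \<le> beta xs i" by simp
    have "beta xs i - k \<noteq> beta xs i'" if "i' < length xs" for i'
    proof
      assume e: "beta xs i - k = beta xs i'"
      then have "beta xs i' < beta xs i" using le assms(2) by simp
      then have "i < i'"
        using beta_strict_antimono[OF assms(1), of i' i] i(1)
        by (metis less_asym' linorder_neqE_nat)
      then show False
        using hook_length_neq_beta_diff[OF assms(1) b _ that] e k le by simp
    qed
    then show "beta xs i \<in> beta_set xs \<and> hook_length xs (i, j) \<le> beta xs i
        \<and> beta xs i - hook_length xs (i, j) \<notin> beta_set xs"
      using i le k unfolding beta_set_def by blast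
  qed
  moreover have "?B \<subseteq> ?f ` ?A"
  proof
    fix x assume x: "x \<in> ?B"
    then obtain i where i: "i < length xs" "x = beta xs i" by (auto simp: beta_set_def)
    have "k \<in> {1..beta xs i}" using x i assms(2) by simp
    moreover have "k \<noteq> beta xs i - beta xs i'" if "i' \<in> {i<..<length xs}" for i'
      using that x i beta_strict_antimono[OF assms(1), of i i'] by (auto simp: beta_set_def)
    ultimately obtain j where "j < xs ! i" "k = hook_length xs (i, j)"
      unfolding hook_lengths_row[OF assms(1) i(1), symmetric] by blast
    then have "(i, j) \<in> ?A" using i by (simp add: young_diagram_def)
    then show "x \<in> ?f ` ?A" using i(2) by (metis (no_types, lifting) case_prod_conv image_eqI)
  qed
  ultimately show ?thesis unfolding bij_betw_def by blast
qed

lemma hook_count_eq_card_beta: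
  assumes "sorted_wrt (\<ge>) xs" "0 < k"
  shows "hook_count k xs = card {x \<in> beta_set xs. k \<le> x \<and> x - k \<notin> beta_set xs}"
  unfolding hook_count_def by (rule bij_betw_same_card[OF bij_betw_hooks_beta_set[OF assms]])

text \<open>Otherwise \<open>x\<close> would be the image of a hook of length exactly
  \<open>t\<close> under the bijection.\<close>

lemma beta_set_diff_core:
  assumes "sorted_wrt (\<ge>) xs" "is_core t xs" "0 < t" "x \<in> beta_set xs" "t \<le> x"
  shows "x - t \<in> beta_set xs"
proof -
  have "{b \<in> young_diagram xs. hook_length xs b = t} = {}"
    using assms(2) by (auto simp: is_core_def)
  then show ?thesis
    using bij_betw_imp_surj_on[OF bij_betw_hooks_beta_set[OF assms(1,3)]] assms(4,5) by blast
qed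

section \<open>Comparing 3-hooks with 1-hooks for 4-cores\<close>

lemma card_3_hooks_le_1_hooks:
  fixes B :: "nat set"
  assumes "finite B" and low: "0 \<notin> B" "1 \<notin> B"
    and closed: "\<And>x. x \<in> B \<Longrightarrow> 4 \<le> x \<Longrightarrow> x - 4 \<in> B"
  shows "card {x \<in> B. 3 \<le> x \<and> x - 3 \<notin> B} \<le> card {x \<in> B. 1 \<le> x \<and> x - 1 \<notin> B}"
proof -
  \<comment> \<open>Repeatedly subtracting 4 stays in \<open>B\<close> and ends below 4, where only
    2 and 3 remain possible.\<close>
  have res: "2 \<le> x mod 4" if "x \<in> B" for x
    using that
  proof (induction x rule: less_induct)
    case (less x)
    show ?case
    proof (cases "4 \<le> x")
      case True
      then have "2 \<le> (x - 4) mod 4"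
        using less.IH[of "x - 4"] closed[OF less.prems] by simp
      then show ?thesis using True by (simp add: le_mod_geq)
    next
      case False
      have "x \<noteq> 0" "x \<noteq> 1" using less.prems low by metis+
      then show ?thesis using False by simp
    qed
  qed
  let ?f = "\<lambda>x. if x - 1 \<in> B then x - 1 else x"
  show ?thesis
  proof (rule card_inj_on_le)
    show "inj_on ?f {x \<in> B. 3 \<le> x \<and> x - 3 \<notin> B}"
    proof (rule linorder_inj_onI)
      fix x y assume xy: "x < y" "x \<in> {x \<in> B. 3 \<le> x \<and> x - 3 \<notin> B}"
        "y \<in> {x \<in> B. 3 \<le> x \<and> x - 3 \<notin> B}"
      have "3 \<le> x" using xy by simp
      \<comment> \<open>For \<open>x < y\<close> the only possible collision is
        \<open>y - 1 = x\<close>. Then \<open>y - 4 = x - 3\<close> would lie in \<open>B\<close> by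
        closure, against the choice of \<open>x\<close>.\<close>
      moreover have "y \<noteq> x + 1"
      proof
        assume "y = x + 1"
        then show False using closed[of y] xy(2,3) by simp
      qed
      ultimately have "x - 1 \<noteq> y - 1" "x - 1 \<noteq> y" "x \<noteq> y - 1" "x \<noteq> y"
        using xy(1) by linarith+
      then show "?f x \<noteq> ?f y" by (cases "x - 1 \<in> B"; cases "y - 1 \<in> B") simp_all
    qed auto
    \<comment> \<open>Shifted values are 1-hooks: three consecutive elements of \<open>B\<close>
      cannot all have residue 2 or 3 modulo 4.\<close>
    have "x - 1 - 1 \<notin> B" if "x \<in> B" "x - 1 \<in> B" for x
    proof
      assume *: "x - 1 - 1 \<in> B"
      define y where "y = x - 1 - 1"
      \<comment> \<open>This excludes truncated subtraction, so \<open>y\<close>,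
        \<open>y + 1\<close>, \<open>y + 2\<close> are truly consecutive.\<close>
      have "y \<noteq> 0" using * low(1) unfolding y_def by metis
      then have "x = y + 2" "x - 1 = y + 1" by (simp_all add: y_def)
      then have "2 \<le> (y + 2) mod 4" "2 \<le> (y + 1) mod 4" "2 \<le> y mod 4"
        using res that * y_def by metis+
      then show False by presburger
    qed
    moreover have "1 \<le> x" if "x \<in> B" for x
      using that low(1) by (cases x) auto
    ultimately show "?f ` {x \<in> B. 3 \<le> x \<and> x - 3 \<notin> B} \<subseteq> {x \<in> B. 1 \<le> x \<and> x - 1 \<notin> B}"
      by auto
  qed (use assms in simp)
qed

lemma hook_count_3_le_hook_count_1:
  assumes "sorted_wrt (\<ge>) xs" "is_core 4 xs" "\<And>x. x \<in> set xs \<Longrightarrow> 2 \<le> x"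
  shows "hook_count 3 xs \<le> hook_count 1 xs"
proof -
  \<comment> \<open>A beta-number is at least its part, so the bound on the parts keeps 0 and 1 out
    of the beta-set.\<close>
  have "2 \<le> beta xs i" if "i < length xs" for i
    using assms(3)[OF nth_mem[OF that]] by (simp add: beta_def)
  then have ge2: "2 \<le> x" if "x \<in> beta_set xs" for x
    using that by (auto simp: beta_set_def)
  have "card {x \<in> beta_set xs. 3 \<le> x \<and> x - 3 \<notin> beta_set xs}
      \<le> card {x \<in> beta_set xs. 1 \<le> x \<and> x - 1 \<notin> beta_set xs}"
  proof (rule card_3_hooks_le_1_hooks)
    show "finite (beta_set xs)" by (simp add: beta_set_def)
    show "0 \<notin> beta_set xs" "1 \<notin> beta_set xs" using ge2 by fastforce+
    show "x - 4 \<in> beta_set xs" if "x \<in> beta_set xs" "4 \<le> x" for x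
      using beta_set_diff_core[OF assms(1,2) _ that] by simp
  qed
  then show ?thesis
    by (simp add: hook_count_eq_card_beta[OF assms(1)])
qed

theorem theorem1p7:
  fixes n :: nat
  shows "core_hooks_avoiding {1} 4 1 n \<ge> core_hooks_avoiding {1} 4 3 n"
  unfolding core_hooks_avoiding_def
proof (rule sum_mono)
  fix xs assume xs: "xs \<in> {xs \<in> partitions n. is_core 4 xs \<and> set xs \<inter> {1} = {}}"
  have "2 \<le> x" if "x \<in> set xs" for x
  proof -
    have "0 < x" "x \<noteq> 1" using that xs by (auto simp: partitions_def)
    then show ?thesis by simp
  qed
  with xs show "hook_count 3 xs \<le> hook_count 1 xs"
    by (intro hook_count_3_le_hook_count_1) (auto simp: partitions_def)
qed

end
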